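(* Consider the dual problem $\inf_{r\ge0,\ \theta\in[0,\pi],\ \phi\in[0,2\pi)}F(r,\theta,\phi)$ subject to $r\sin\theta\cos\phi\ge0$, where $$F(r,\theta,\phi)=r\sin\theta\cos\phi\,\delta+r\cos\theta\,\mu+r\sin\theta\sin\phi\,(\sigma^2+\mu^2)+\frac1n\sum_{k=1}^n\sup_{x\in\mathbb{R}}\big[(\tau-x)_+-r\sin\theta\cos\phi\,(x-x_k)^2-r\cos\theta\,x-r\sin\theta\sin\phi\,x^2\big].$$ Its solution can be computed (approximately) using a two-dimensional grid search in angles $(\theta,\phi)$ subject to the constraint $\sin\theta(\cos\phi+\sin\phi)>0$ and evaluating $F$ for each point in a list $L$ of tuples $(\theta_i,\phi_j,r^*_{ij})$. The list $L$ is constructed by doing a linear search on $r\ge0$ for each tuple $(\theta_i,\phi_j)$ to find the critical point $r^*_{ij}$, where the optimality condition for the subgradient $\partial F(r^*_{ij})$ says that $$\partial_r^-F(r^*_{ij})\le0\le\partial_r^+F(r^*_{ij}),$$ and the left and right partial derivatives of $F$ evaluated at $r=r^*_{ij}$ are $$\partial_r^-F(r^*_{ij})=\alpha-\frac{\alpha_0}n\sum_kx_k^2+\frac1n\Big[\sum_k\beta_k-\sum_{k\in K_1}\frac1{4(r^*_{ij})^2\tilde a}\Big],\qquad \partial_r^+F(r^*_{ij})=\alpha-\frac{\alpha_0}n\sum_kx_k^2+\frac1n\Big[\sum_k\beta_k-\sum_{k\in K_2}\frac1{4(r^*_{ij})^2\tilde a}\Big],$$ where $\alpha_0:=\sin\theta_i\cos\phi_j$,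 $\alpha:=\alpha_0\delta+\cos\theta_i\,\mu+\sin\theta_i\sin\phi_j(\sigma^2+\mu^2)$, $\tilde a:=\sin\theta_i(\cos\phi_j+\sin\phi_j)$, $\tilde b_k:=\sin\theta_i\cos\phi_j\,x_k-\frac12\cos\theta_i$, $\beta_k=\tilde b_k^2/\tilde a$, and $$K_1(r^*_{ij}):=\Big\{k:\tau-\Big(\frac{\tilde b_k}{\tilde a}-\frac1{4r^*_{ij}\tilde a}\Big)\ge0\Big\},\qquad K_2(r^*_{ij}):=\Big\{k:\tau-\Big(\frac{\tilde b_k}{\tilde a}-\frac1{4r^*_{ij}\tilde a}\Big)>0\Big\}.$$
   Context: Data: $n\ge1$, real numbers $x_1,\dots,x_n$, $\tau,\mu\in\mathbb{R}$, $\sigma\ge0$, $\delta\ge0$; $(z)_+=\max(z,0)$. The variables $(r,\theta,\phi)$ are spherical coordinates $\lambda_1=r\sin\theta\cos\phi\ge0$, $\lambda_2=r\cos\theta$, $\lambda_3=r\sin\theta\sin\phi$ for dual variables $(\lambda_1,\lambda_2,\lambda_3)$. The $(\theta_i,\phi_j)$ are the grid points. $\partial_r^\pm$ denote one-sided derivatives and $\partial F$ the subdifferential in $r$ with $(\theta_i,\phi_j)$ fixed. The approximate solution is the minimum of $F$ over the list $L$.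
   Formalization: Critical points may fail to exist, so tuples without one are omitted from L; L also respects sinθ cosφ≥0; approximation is claimed only when the dual infimum is finite, and if it is −∞ then F is unbounded below in r at some grid angle. *)

theory Defs
  imports "HOL-Analysis.Analysis"
begin

text \<open>
  The data are the sample size \<open>n\<close>, the sample points \<open>x 1, \<dots>, x n\<close> (only these values of \<open>x\<close> are
  used) and the reals \<open>\<tau>\<close>, \<open>\<mu>\<close>, \<open>\<sigma>\<close>, \<open>\<delta>\<close>.
  The objective is extended-real valued: the supremum is \<open>\<infinity>\<close> if \<open>r = 0\<close>, and also if
  \<open>sin \<theta> * (cos \<phi> + sin \<phi>) \<le> 0\<close>.
\<close>

definition F :: "nat \<Rightarrow> (nat \<Rightarrow> real) \<Rightarrow> real \<Rightarrow> real \<Rightarrow> real \<Rightarrow> real \<Rightarrow> real \<Rightarrow> real \<Rightarrow> real \<Rightarrow> ereal" where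
  "F n x \<tau> \<mu> \<sigma> \<delta> r \<theta> \<phi> =
     ereal (r * sin \<theta> * cos \<phi> * \<delta> + r * cos \<theta> * \<mu> + r * sin \<theta> * sin \<phi> * (\<sigma>\<^sup>2 + \<mu>\<^sup>2))
     + ereal (1 / real n) * (\<Sum>k=1..n. SUP y::real.
         ereal (max (\<tau> - y) 0 - r * sin \<theta> * cos \<phi> * (y - x k)\<^sup>2
                - r * cos \<theta> * y - r * sin \<theta> * sin \<phi> * y\<^sup>2))"

definition dual_value :: "nat \<Rightarrow> (nat \<Rightarrow> real) \<Rightarrow> real \<Rightarrow> real \<Rightarrow> real \<Rightarrow> real \<Rightarrow> ereal" where
  "dual_value n x \<tau> \<mu> \<sigma> \<delta> =
     (INF (r, \<theta>, \<phi>) \<in> {(r, \<theta>, \<phi>). 0 \<le> r \<and> \<theta> \<in> {0..pi} \<and> \<phi> \<in> {0..<2 * pi} \<and> 0 \<le> r * sin \<theta> * cos \<phi>}.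
        F n x \<tau> \<mu> \<sigma> \<delta> r \<theta> \<phi>)"

definition alpha0 :: "real \<Rightarrow> real \<Rightarrow> real" where
  "alpha0 \<theta> \<phi> = sin \<theta> * cos \<phi>"

definition alpha :: "real \<Rightarrow> real \<Rightarrow> real \<Rightarrow> real \<Rightarrow> real \<Rightarrow> real" where
  "alpha \<mu> \<sigma> \<delta> \<theta> \<phi> = alpha0 \<theta> \<phi> * \<delta> + cos \<theta> * \<mu> + sin \<theta> * sin \<phi> * (\<sigma>\<^sup>2 + \<mu>\<^sup>2)"

definition a_tilde :: "real \<Rightarrow> real \<Rightarrow> real" where
  "a_tilde \<theta> \<phi> = sin \<theta> * (cos \<phi> + sin \<phi>)"

definition b_tilde :: "(nat \<Rightarrow> real) \<Rightarrow> real \<Rightarrow> real \<Rightarrow> nat \<Rightarrow> real" where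
  "b_tilde x \<theta> \<phi> k = sin \<theta> * cos \<phi> * x k - (1 / 2) * cos \<theta>"

definition beta :: "(nat \<Rightarrow> real) \<Rightarrow> real \<Rightarrow> real \<Rightarrow> nat \<Rightarrow> real" where
  "beta x \<theta> \<phi> k = (b_tilde x \<theta> \<phi> k)\<^sup>2 / a_tilde \<theta> \<phi>"

definition K1 :: "nat \<Rightarrow> (nat \<Rightarrow> real) \<Rightarrow> real \<Rightarrow> real \<Rightarrow> real \<Rightarrow> real \<Rightarrow> nat set" where
  "K1 n x \<tau> \<theta> \<phi> r =
     {k \<in> {1..n}. \<tau> - (b_tilde x \<theta> \<phi> k / a_tilde \<theta> \<phi> - 1 / (4 * r * a_tilde \<theta> \<phi>)) \<ge> 0}"

definition K2 :: "nat \<Rightarrow> (nat \<Rightarrow> real) \<Rightarrow> real \<Rightarrow> real \<Rightarrow> real \<Rightarrow> real \<Rightarrow> nat set" where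
  "K2 n x \<tau> \<theta> \<phi> r =
     {k \<in> {1..n}. \<tau> - (b_tilde x \<theta> \<phi> k / a_tilde \<theta> \<phi> - 1 / (4 * r * a_tilde \<theta> \<phi>)) > 0}"

definition left_formula :: "nat \<Rightarrow> (nat \<Rightarrow> real) \<Rightarrow> real \<Rightarrow> real \<Rightarrow> real \<Rightarrow> real \<Rightarrow> real \<Rightarrow> real \<Rightarrow> real \<Rightarrow> real" where
  "left_formula n x \<tau> \<mu> \<sigma> \<delta> r \<theta> \<phi> =
     alpha \<mu> \<sigma> \<delta> \<theta> \<phi> - alpha0 \<theta> \<phi> / real n * (\<Sum>k=1..n. (x k)\<^sup>2)
     + 1 / real n * ((\<Sum>k=1..n. beta x \<theta> \<phi> k) - (\<Sum>k\<in>K1 n x \<tau> \<theta> \<phi> r. 1 / (4 * r\<^sup>2 * a_tilde \<theta> \<phi>)))"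

definition right_formula :: "nat \<Rightarrow> (nat \<Rightarrow> real) \<Rightarrow> real \<Rightarrow> real \<Rightarrow> real \<Rightarrow> real \<Rightarrow> real \<Rightarrow> real \<Rightarrow> real \<Rightarrow> real" where
  "right_formula n x \<tau> \<mu> \<sigma> \<delta> r \<theta> \<phi> =
     alpha \<mu> \<sigma> \<delta> \<theta> \<phi> - alpha0 \<theta> \<phi> / real n * (\<Sum>k=1..n. (x k)\<^sup>2)
     + 1 / real n * ((\<Sum>k=1..n. beta x \<theta> \<phi> k) - (\<Sum>k\<in>K2 n x \<tau> \<theta> \<phi> r. 1 / (4 * r\<^sup>2 * a_tilde \<theta> \<phi>)))"

text \<open>Subdifferential (in the sense of convex analysis) at \<open>r\<close> of an extended-real function on \<open>S\<close>;
  empty where the function is not finite.\<close>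

definition subdiff_on :: "real set \<Rightarrow> (real \<Rightarrow> ereal) \<Rightarrow> real \<Rightarrow> real set" where
  "subdiff_on S f r = {v. r \<in> S \<and> \<bar>f r\<bar> \<noteq> \<infinity> \<and> (\<forall>s\<in>S. f r + ereal (v * (s - r)) \<le> f s)}"

definition critical :: "nat \<Rightarrow> (nat \<Rightarrow> real) \<Rightarrow> real \<Rightarrow> real \<Rightarrow> real \<Rightarrow> real \<Rightarrow> real \<Rightarrow> real \<Rightarrow> real \<Rightarrow> bool" where
  "critical n x \<tau> \<mu> \<sigma> \<delta> r \<theta> \<phi> \<longleftrightarrow> 0 \<in> subdiff_on {0..} (\<lambda>s. F n x \<tau> \<mu> \<sigma> \<delta> s \<theta> \<phi>) r"

text \<open>The second condition is the sign constraint of the dual problem (for \<open>r > 0\<close>).\<close>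

definition admissible :: "real \<Rightarrow> real \<Rightarrow> bool" where
  "admissible \<theta> \<phi> \<longleftrightarrow> 0 < sin \<theta> * (cos \<phi> + sin \<phi>) \<and> 0 \<le> sin \<theta> * cos \<phi>"

text \<open>The grid is \<open>\<Theta> \<times> \<Phi>\<close>; every angle is within \<open>\<eta>\<close> of a grid value, in each coordinate.\<close>

definition angle_grid :: "real \<Rightarrow> real set \<Rightarrow> real set \<Rightarrow> bool" where
  "angle_grid \<eta> \<Theta> \<Phi> \<longleftrightarrow>
     finite \<Theta> \<and> \<Theta> \<subseteq> {0..pi} \<and> (\<forall>\<theta>\<in>{0..pi}. \<exists>\<theta>'\<in>\<Theta>. \<bar>\<theta> - \<theta>'\<bar> \<le> \<eta>) \<and>
     finite \<Phi> \<and> \<Phi> \<subseteq> {0..<2 * pi} \<and> (\<forall>\<phi>\<in>{0..<2 * pi}. \<exists>\<phi>'\<in>\<Phi>. \<bar>\<phi> - \<phi>'\<bar> \<le> \<eta>)"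

text \<open>
  A list produced by the search. For some angles \<open>F\<close> has no critical point in \<open>r\<close> (its infimum is
  not attained, or is \<open>-\<infinity>\<close>); they contribute no entry. Critical points need not be unique;
  the list holds at least one for each remaining admissible grid point.
\<close>

definition search_list ::
  "nat \<Rightarrow> (nat \<Rightarrow> real) \<Rightarrow> real \<Rightarrow> real \<Rightarrow> real \<Rightarrow> real \<Rightarrow> real set \<Rightarrow> real set \<Rightarrow> (real \<times> real \<times> real) list \<Rightarrow> bool" where
  "search_list n x \<tau> \<mu> \<sigma> \<delta> \<Theta> \<Phi> L \<longleftrightarrow>
     (\<forall>(\<theta>, \<phi>, r) \<in> set L. \<theta> \<in> \<Theta> \<and> \<phi> \<in> \<Phi> \<and> admissible \<theta> \<phi> \<and> critical n x \<tau> \<mu> \<sigma> \<delta> r \<theta> \<phi>) \<and>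
     (\<forall>\<theta>\<in>\<Theta>. \<forall>\<phi>\<in>\<Phi>. admissible \<theta> \<phi> \<and> (\<exists>r. critical n x \<tau> \<mu> \<sigma> \<delta> r \<theta> \<phi>) \<longrightarrow> (\<exists>r. (\<theta>, \<phi>, r) \<in> set L))"

definition list_min ::
  "nat \<Rightarrow> (nat \<Rightarrow> real) \<Rightarrow> real \<Rightarrow> real \<Rightarrow> real \<Rightarrow> real \<Rightarrow> (real \<times> real \<times> real) list \<Rightarrow> ereal" where
  "list_min n x \<tau> \<mu> \<sigma> \<delta> L = Min ((\<lambda>(\<theta>, \<phi>, r). F n x \<tau> \<mu> \<sigma> \<delta> r \<theta> \<phi>) ` set L)"

end

theory Submission
  imports Defs
begin

text \<open>
  On a ray of fixed angles with \<open>a_tilde \<theta> \<phi> > 0\<close> the inner suprema can be evaluated: each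
  integrand is the maximum of two concave quadratics in \<open>y\<close>, one for each branch of
  \<open>max (\<tau> - y) 0\<close>, and the supremum of the maximum is the larger of the two vertex values. Hence for
  \<open>r > 0\<close>
  the objective is \<open>r * C + (\<Sum>k. max e\<^sub>k 0) / n\<close>, where \<open>e\<^sub>k = \<tau> - b\<^sub>k / a + 1 / (4 * r * a)\<close> with
  \<open>a\<close> and \<open>b\<^sub>k\<close> for \<open>a_tilde\<close> and \<open>b_tilde\<close>, \<open>C\<close> (\<open>slope\<close>) depends on the angles only and \<open>e\<^sub>k\<close> (\<open>excess\<close>) decreases in \<open>r\<close>
  (\<open>F_eq_F_real\<close>); for \<open>r * a_tilde \<theta> \<phi> \<le> 0\<close> the value is \<open>\<infinity>\<close> (\<open>F_eq_PInf\<close>). The sets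
  \<open>K1\<close> and \<open>K2\<close> collect the \<open>k\<close> with \<open>e\<^sub>k \<ge> 0\<close> and \<open>e\<^sub>k > 0\<close>. To the left of a zero of \<open>e\<^sub>k\<close> the
  positive part follows \<open>e\<^sub>k\<close> and to the right it vanishes, which gives the two one-sided derivatives.
  Both are also subgradients, because \<open>1/s\<close> lies above its tangents, and so the sign condition is
  equivalent to global minimality in \<open>r\<close> (\<open>critical_iff_formulas\<close>).

  For the grid search the sign of \<open>C\<close> decides everything. If \<open>C > 0\<close>, then \<open>F\<close> tends to infinity at
  both ends of \<open>(0, \<infinity>)\<close> and a critical point exists (\<open>critical_exists\<close>). If \<open>C < 0\<close>, then the
  infimum over \<open>r\<close> is \<open>-\<infinity>\<close> (\<open>INF_eq_MInf\<close>). If \<open>C = 0\<close>, a critical point may fail to exist, and the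
  grid must be shown not to consist of such angles only. For fixed \<open>\<phi>\<close>, however,
  \<open>a_tilde \<theta> \<phi> * C\<close> is \<open>(sin \<theta>)\<^sup>2\<close> times a quadratic polynomial in \<open>cot \<theta>\<close> with leading coefficient
  \<open>1/4\<close>, so that \<open>C\<close> has finitely many zeros \<open>\<theta>\<close> (\<open>finite_zeros_slope\<close>). Since all quantities are
  continuous in the angles, any admissible angle that is good enough can be moved to one around which
  a whole neighbourhood consists of good admissible angles with \<open>C \<noteq> 0\<close>
  (\<open>generic_admissible_angle\<close>), and every fine enough grid has a point there.

  If the dual value is finite, \<open>C \<ge> 0\<close> at all admissible angles; the grid point found near a
  nearly optimal ray then has \<open>C > 0\<close>, so it contributes a minimiser in \<open>r\<close>, whose value is within
  \<open>\<epsilon>\<close> of the dual value (\<open>finite_dual\<close>). If the dual value is \<open>-\<infinity>\<close>, then \<open>C < 0\<close> at some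
  admissible angle, as \<open>F \<ge> r * C\<close>, and this persists at a nearby grid point (\<open>unbounded_dual\<close>).
\<close>

section \<open>The objective along a ray\<close>

text \<open>
  The limit of \<open>F / r\<close> as \<open>r \<rightarrow> \<infinity>\<close> at fixed angles with \<open>a_tilde \<theta> \<phi> > 0\<close>.
\<close>

definition slope :: "nat \<Rightarrow> (nat \<Rightarrow> real) \<Rightarrow> real \<Rightarrow> real \<Rightarrow> real \<Rightarrow> real \<Rightarrow> real \<Rightarrow> real" where
  "slope n x \<mu> \<sigma> \<delta> \<theta> \<phi> =
     alpha \<mu> \<sigma> \<delta> \<theta> \<phi> - alpha0 \<theta> \<phi> / real n * (\<Sum>k=1..n. (x k)\<^sup>2)
     + 1 / real n * (\<Sum>k=1..n. beta x \<theta> \<phi> k)"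

text \<open>
  The amount by which the vertex value of the branch \<open>\<tau> - y\<close> exceeds that of the branch \<open>0\<close> in the
  \<open>k\<close>-th inner supremum.
\<close>

definition excess :: "(nat \<Rightarrow> real) \<Rightarrow> real \<Rightarrow> real \<Rightarrow> real \<Rightarrow> real \<Rightarrow> nat \<Rightarrow> real" where
  "excess x \<tau> \<theta> \<phi> r k =
     \<tau> - (b_tilde x \<theta> \<phi> k / a_tilde \<theta> \<phi> - 1 / (4 * r * a_tilde \<theta> \<phi>))"

definition F_real ::
  "nat \<Rightarrow> (nat \<Rightarrow> real) \<Rightarrow> real \<Rightarrow> real \<Rightarrow> real \<Rightarrow> real \<Rightarrow> real \<Rightarrow> real \<Rightarrow> real \<Rightarrow> real" where
  "F_real n x \<tau> \<mu> \<sigma> \<delta> r \<theta> \<phi> =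
     r * slope n x \<mu> \<sigma> \<delta> \<theta> \<phi> + 1 / real n * (\<Sum>k=1..n. max (excess x \<tau> \<theta> \<phi> r k) 0)"

text \<open>
  Completing the square in both branches: the vertices are \<open>B / A\<close> and \<open>(B - 1 / 2) / A\<close>, with values
  \<open>B\<^sup>2 / A\<close> and \<open>t + (B - 1 / 2)\<^sup>2 / A\<close>. The vertex of one branch may lie where the other branch is
  larger; this does no harm, since the hinge dominates each branch everywhere.
\<close>

lemma SUP_hinge_concave_quadratic:
  fixes A B t :: real
  assumes "A > 0"
  shows "(SUP y::real. ereal (max (t - y) 0 - A * y\<^sup>2 + 2 * B * y))
    = ereal (B\<^sup>2 / A + max (t - (B / A - 1 / (4 * A))) 0)" (is "(SUP y. ereal (?g y)) = ereal ?m")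
proof (rule antisym)
  have sq: "- A * y\<^sup>2 + 2 * C * y = C\<^sup>2 / A - A * (y - C / A)\<^sup>2" for y C
    using assms by (simp add: field_simps power2_eq_square)
  \<comment> \<open>The branch \<open>t - y\<close> is the branch \<open>0\<close> with \<open>B\<close> replaced by \<open>B - 1 / 2\<close>, plus \<open>t\<close>.\<close>
  have shift: "(B - 1 / 2)\<^sup>2 / A = B\<^sup>2 / A - B / A + 1 / (4 * A)"
    using assms by (simp add: field_simps power2_eq_square)
  have lin: "t - y - A * y\<^sup>2 + 2 * B * y
      = t - (B / A - 1 / (4 * A)) + B\<^sup>2 / A - A * (y - (B - 1 / 2) / A)\<^sup>2" for y
    using sq[of y "B - 1 / 2"] shift by (simp add: algebra_simps)
  have nn: "0 \<le> A * z\<^sup>2" for z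
    using assms by simp
  have "?g y \<le> ?m" for y
    using lin[of y] sq[of y B] nn[of "y - B / A"] nn[of "y - (B - 1 / 2) / A"] by (simp add: max_def)
  then show "(SUP y. ereal (?g y)) \<le> ereal ?m"
    by (intro SUP_least) simp
  have "?m \<le> ?g (B / A) \<or> ?m \<le> ?g ((B - 1 / 2) / A)"
    using lin[of "(B - 1 / 2) / A"] sq[of "B / A" B] by (simp add: max_def)
  then show "ereal ?m \<le> (SUP y. ereal (?g y))"
    by (meson SUP_upper2 UNIV_I ereal_less_eq(3))
qed

text \<open>
  Boundedness above would need \<open>2 * B \<le> 0\<close> at \<open>\<infinity>\<close>, where the hinge is constant, and \<open>2 * B \<ge> 1\<close> at
  \<open>-\<infinity>\<close>, where it has slope \<open>-1\<close>.
\<close>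

lemma SUP_hinge_convex_quadratic:
  fixes A B c t :: real
  assumes "A \<le> 0"
  shows "(SUP y::real. ereal (max (t - y) 0 - A * y\<^sup>2 + 2 * B * y + c)) = \<infinity>"
proof (rule SUP_PInfty)
  fix N :: nat
  have nn: "A * y\<^sup>2 \<le> 0" for y
    using assms by (simp add: mult_nonpos_nonneg)
  show "\<exists>y\<in>UNIV. ereal (real N) \<le> ereal (max (t - y) 0 - A * y\<^sup>2 + 2 * B * y + c)"
  proof (cases "B > 0")
    case True
    have "real N \<le> 2 * B * ((\<bar>c\<bar> + real N) / (2 * B)) + c"
      using True by simp
    then show ?thesis
      using nn[of "(\<bar>c\<bar> + real N) / (2 * B)"]
      by (intro bexI[of _ "(\<bar>c\<bar> + real N) / (2 * B)"]) auto
  next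
    case False
    define y where "y = \<bar>t\<bar> + \<bar>c\<bar> + real N"
    have "2 * B * y \<le> 0"
      using False by (simp add: y_def mult_nonpos_nonneg)
    moreover have "real N \<le> t - - y + c"
      unfolding y_def by linarith
    then have "real N \<le> max (t - - y) 0 + c"
      by linarith
    ultimately have "real N \<le> max (t - - y) 0 - A * (- y)\<^sup>2 + 2 * B * (- y) + c"
      using nn[of "- y"] by (simp only: mult_minus_right)
    then show ?thesis
      by (intro bexI[of _ "- y"]) auto
  qed
qed

lemma F_inner_expand:
  "max (\<tau> - y) 0 - r * sin \<theta> * cos \<phi> * (y - x k)\<^sup>2 - r * cos \<theta> * y - r * sin \<theta> * sin \<phi> * y\<^sup>2
   = max (\<tau> - y) 0 - (r * a_tilde \<theta> \<phi>) * y\<^sup>2 + 2 * (r * b_tilde x \<theta> \<phi> k) * y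
     + - (r * alpha0 \<theta> \<phi> * (x k)\<^sup>2)"
  by (simp add: a_tilde_def b_tilde_def alpha0_def algebra_simps power2_eq_square)

lemma F_eq_PInf:
  assumes "n \<ge> 1" "r * a_tilde \<theta> \<phi> \<le> 0"
  shows "F n x \<tau> \<mu> \<sigma> \<delta> r \<theta> \<phi> = \<infinity>"
proof -
  have "(\<Sum>k=1..n. \<infinity> :: ereal) = \<infinity>"
    using assms(1) by (subst sum_Pinfty) auto
  then show ?thesis
    unfolding F_def F_inner_expand SUP_hinge_convex_quadratic[OF assms(2)]
    using assms(1) by simp
qed

lemma F_eq_F_real:
  assumes "n \<ge> 1" "r > 0" "a_tilde \<theta> \<phi> > 0"
  shows "F n x \<tau> \<mu> \<sigma> \<delta> r \<theta> \<phi> = ereal (F_real n x \<tau> \<mu> \<sigma> \<delta> r \<theta> \<phi>)"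
proof -
  have "(SUP y. ereal (max (\<tau> - y) 0 - (r * a_tilde \<theta> \<phi>) * y\<^sup>2
         + 2 * (r * b_tilde x \<theta> \<phi> k) * y + - (r * alpha0 \<theta> \<phi> * (x k)\<^sup>2)))
     = ereal (r * beta x \<theta> \<phi> k - r * alpha0 \<theta> \<phi> * (x k)\<^sup>2 + max (excess x \<tau> \<theta> \<phi> r k) 0)" for k
  proof -
    have A: "r * a_tilde \<theta> \<phi> > 0" using assms by simp
    have "(SUP y. ereal (max (\<tau> - y) 0 - (r * a_tilde \<theta> \<phi>) * y\<^sup>2
         + 2 * (r * b_tilde x \<theta> \<phi> k) * y + - (r * alpha0 \<theta> \<phi> * (x k)\<^sup>2)))
       = (SUP y. ereal (max (\<tau> - y) 0 - (r * a_tilde \<theta> \<phi>) * y\<^sup>2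
         + 2 * (r * b_tilde x \<theta> \<phi> k) * y)) + ereal (- (r * alpha0 \<theta> \<phi> * (x k)\<^sup>2))"
      by (subst SUP_ereal_add_left[symmetric]) simp_all
    also have "\<dots> = ereal (r * beta x \<theta> \<phi> k - r * alpha0 \<theta> \<phi> * (x k)\<^sup>2 + max (excess x \<tau> \<theta> \<phi> r k) 0)"
      unfolding SUP_hinge_concave_quadratic[OF A] excess_def beta_def
      using assms by (simp add: power2_eq_square mult_ac)
    finally show ?thesis .
  qed
  then have "F n x \<tau> \<mu> \<sigma> \<delta> r \<theta> \<phi> = ereal (r * alpha \<mu> \<sigma> \<delta> \<theta> \<phi> + 1 / real n *
      (\<Sum>k=1..n. r * beta x \<theta> \<phi> k - r * alpha0 \<theta> \<phi> * (x k)\<^sup>2 + max (excess x \<tau> \<theta> \<phi> r k) 0))"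
    unfolding F_def F_inner_expand by (simp add: alpha_def alpha0_def algebra_simps)
  also have "r * alpha \<mu> \<sigma> \<delta> \<theta> \<phi> + 1 / real n *
      (\<Sum>k=1..n. r * beta x \<theta> \<phi> k - r * alpha0 \<theta> \<phi> * (x k)\<^sup>2 + max (excess x \<tau> \<theta> \<phi> r k) 0)
      = F_real n x \<tau> \<mu> \<sigma> \<delta> r \<theta> \<phi>"
    unfolding F_real_def slope_def
    by (simp add: sum.distrib sum_subtractf sum_distrib_left[symmetric] algebra_simps)
  finally show ?thesis .
qed

section \<open>One-sided derivatives and critical points\<close>

text \<open>
  In this form and the next one, the formulas agree term by term with the one-sided derivatives of
  the positive parts.
\<close>

lemma left_formula_eq:
  "left_formula n x \<tau> \<mu> \<sigma> \<delta> r \<theta> \<phi> = slope n x \<mu> \<sigma> \<delta> \<theta> \<phi> + 1 / real n *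
     (\<Sum>k=1..n. if excess x \<tau> \<theta> \<phi> r k \<ge> 0 then - 1 / (4 * r\<^sup>2 * a_tilde \<theta> \<phi>) else 0)"
proof -
  have "(\<Sum>k\<in>K1 n x \<tau> \<theta> \<phi> r. 1 / (4 * r\<^sup>2 * a_tilde \<theta> \<phi>))
      = - (\<Sum>k=1..n. if excess x \<tau> \<theta> \<phi> r k \<ge> 0 then - 1 / (4 * r\<^sup>2 * a_tilde \<theta> \<phi>) else 0)"
    unfolding K1_def excess_def[symmetric] sum.inter_filter[OF finite_atLeastAtMost] sum_negf[symmetric]
    by (intro sum.cong) auto
  then show ?thesis
    by (simp add: left_formula_def slope_def right_diff_distrib distrib_left)
qed

lemma right_formula_eq:
  "right_formula n x \<tau> \<mu> \<sigma> \<delta> r \<theta> \<phi> = slope n x \<mu> \<sigma> \<delta> \<theta> \<phi> + 1 / real n *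
     (\<Sum>k=1..n. if excess x \<tau> \<theta> \<phi> r k > 0 then - 1 / (4 * r\<^sup>2 * a_tilde \<theta> \<phi>) else 0)"
proof -
  have "(\<Sum>k\<in>K2 n x \<tau> \<theta> \<phi> r. 1 / (4 * r\<^sup>2 * a_tilde \<theta> \<phi>))
      = - (\<Sum>k=1..n. if excess x \<tau> \<theta> \<phi> r k > 0 then - 1 / (4 * r\<^sup>2 * a_tilde \<theta> \<phi>) else 0)"
    unfolding K2_def excess_def[symmetric] sum.inter_filter[OF finite_atLeastAtMost] sum_negf[symmetric]
    by (intro sum.cong) auto
  then show ?thesis
    by (simp add: right_formula_def slope_def right_diff_distrib distrib_left)
qed

lemma excess_has_derivative:
  assumes "r > 0" "a_tilde \<theta> \<phi> > 0"
  shows "((\<lambda>s. excess x \<tau> \<theta> \<phi> s k) has_real_derivative - 1 / (4 * r\<^sup>2 * a_tilde \<theta> \<phi>)) (at r within S)"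
  unfolding excess_def using assms
  by (auto intro!: derivative_eq_intros simp: power2_eq_square field_simps)

lemma excess_antimono:
  assumes "0 < s" "s \<le> r" "a_tilde \<theta> \<phi> > 0"
  shows "excess x \<tau> \<theta> \<phi> r k \<le> excess x \<tau> \<theta> \<phi> s k"
  unfolding excess_def using assms by (simp add: frac_le)

lemma excess_tendsto:
  assumes "r > 0" "a_tilde \<theta> \<phi> > 0"
  shows "((\<lambda>s. excess x \<tau> \<theta> \<phi> s k) \<longlongrightarrow> excess x \<tau> \<theta> \<phi> r k) (at r within S)"
  using DERIV_isCont[OF excess_has_derivative[OF assms, where S = UNIV]]
  unfolding isCont_def using tendsto_within_subset by blast

lemma excess_pos_part_left_derivative:
  assumes r: "r > 0" and a: "a_tilde \<theta> \<phi> > 0"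
  shows "((\<lambda>s. max (excess x \<tau> \<theta> \<phi> s k) 0) has_real_derivative
    (if excess x \<tau> \<theta> \<phi> r k \<ge> 0 then - 1 / (4 * r\<^sup>2 * a_tilde \<theta> \<phi>) else 0)) (at_left r)"
proof (cases "excess x \<tau> \<theta> \<phi> r k \<ge> 0")
  case True
  have "\<forall>\<^sub>F s in at_left r. s \<in> {0<..<r}"
    using r by (intro eventually_at_leftI[of 0]) auto
  then have "\<forall>\<^sub>F s in at_left r. max (excess x \<tau> \<theta> \<phi> s k) 0 = excess x \<tau> \<theta> \<phi> s k"
  proof eventually_elim
    case (elim s)
    then have "excess x \<tau> \<theta> \<phi> r k \<le> excess x \<tau> \<theta> \<phi> s k"
      using a by (intro excess_antimono) auto
    with True show ?case by simp
  qed
  with True show ?thesis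
    using excess_has_derivative[OF r a]
    by (subst has_field_derivative_cong_eventually) auto
next
  case False
  then have "\<forall>\<^sub>F s in at_left r. excess x \<tau> \<theta> \<phi> s k < 0"
    by (intro order_tendstoD(2)[OF excess_tendsto[OF r a]]) simp
  then have "\<forall>\<^sub>F s in at_left r. max (excess x \<tau> \<theta> \<phi> s k) 0 = 0"
    by eventually_elim simp
  with False show ?thesis
    by (subst has_field_derivative_cong_eventually) auto
qed

lemma excess_pos_part_right_derivative:
  assumes r: "r > 0" and a: "a_tilde \<theta> \<phi> > 0"
  shows "((\<lambda>s. max (excess x \<tau> \<theta> \<phi> s k) 0) has_real_derivative
    (if excess x \<tau> \<theta> \<phi> r k > 0 then - 1 / (4 * r\<^sup>2 * a_tilde \<theta> \<phi>) else 0)) (at_right r)"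
proof (cases "excess x \<tau> \<theta> \<phi> r k > 0")
  case True
  then have "\<forall>\<^sub>F s in at_right r. excess x \<tau> \<theta> \<phi> s k > 0"
    by (intro order_tendstoD(1)[OF excess_tendsto[OF r a]])
  then have "\<forall>\<^sub>F s in at_right r. max (excess x \<tau> \<theta> \<phi> s k) 0 = excess x \<tau> \<theta> \<phi> s k"
    by eventually_elim simp
  with True show ?thesis
    using excess_has_derivative[OF r a]
    by (subst has_field_derivative_cong_eventually) auto
next
  case False
  have "\<forall>\<^sub>F s in at_right r. s > r"
    by (simp add: eventually_at_right_less)
  then have "\<forall>\<^sub>F s in at_right r. max (excess x \<tau> \<theta> \<phi> s k) 0 = 0"
  proof eventually_elim
    case (elim s)
    then have "excess x \<tau> \<theta> \<phi> s k \<le> excess x \<tau> \<theta> \<phi> r k"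
      using r a by (intro excess_antimono) auto
    with False show ?case by simp
  qed
  with False show ?thesis
    by (subst has_field_derivative_cong_eventually) auto
qed

lemma F_real_left_derivative:
  assumes "r > 0" "a_tilde \<theta> \<phi> > 0"
  shows "((\<lambda>s. F_real n x \<tau> \<mu> \<sigma> \<delta> s \<theta> \<phi>) has_real_derivative
    left_formula n x \<tau> \<mu> \<sigma> \<delta> r \<theta> \<phi>) (at_left r)"
  unfolding F_real_def left_formula_eq
  by (intro DERIV_add DERIV_cmult DERIV_sum excess_pos_part_left_derivative assms)
     (auto intro!: derivative_eq_intros)

lemma F_real_right_derivative:
  assumes "r > 0" "a_tilde \<theta> \<phi> > 0"
  shows "((\<lambda>s. F_real n x \<tau> \<mu> \<sigma> \<delta> s \<theta> \<phi>) has_real_derivative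
    right_formula n x \<tau> \<mu> \<sigma> \<delta> r \<theta> \<phi>) (at_right r)"
  unfolding F_real_def right_formula_eq
  by (intro DERIV_add DERIV_cmult DERIV_sum excess_pos_part_right_derivative assms)
     (auto intro!: derivative_eq_intros)

text \<open>
  The gap between \<open>excess\<close> and its tangent at \<open>r\<close> is the square \<open>(s - r)\<^sup>2 / (4 * r\<^sup>2 * s * a_tilde \<theta> \<phi>)\<close>.
\<close>

lemma excess_subgradient:
  assumes "r > 0" "s > 0" "a_tilde \<theta> \<phi> > 0"
  shows "excess x \<tau> \<theta> \<phi> r k + - 1 / (4 * r\<^sup>2 * a_tilde \<theta> \<phi>) * (s - r) \<le> excess x \<tau> \<theta> \<phi> s k"
proof -
  have "excess x \<tau> \<theta> \<phi> s k - excess x \<tau> \<theta> \<phi> r k - - 1 / (4 * r\<^sup>2 * a_tilde \<theta> \<phi>) * (s - r)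
      = (s - r)\<^sup>2 / (4 * r\<^sup>2 * s * a_tilde \<theta> \<phi>)"
    unfolding excess_def using assms by (simp add: field_simps power2_eq_square)
  moreover have "\<dots> \<ge> 0" using assms by simp
  ultimately show ?thesis by linarith
qed

text \<open>
  At a kink, where the excess vanishes, both choices of \<open>g k\<close> are possible. Thus one statement makes
  the left and the right formula subgradients, which replaces a proof of convexity.
\<close>

lemma F_real_subgradient:
  assumes "r > 0" "s > 0" "a_tilde \<theta> \<phi> > 0"
    and g: "\<And>k. (g k = - 1 / (4 * r\<^sup>2 * a_tilde \<theta> \<phi>) \<and> excess x \<tau> \<theta> \<phi> r k \<ge> 0)
                \<or> (g k = 0 \<and> excess x \<tau> \<theta> \<phi> r k \<le> 0)"
  shows "F_real n x \<tau> \<mu> \<sigma> \<delta> r \<theta> \<phi>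
      + (slope n x \<mu> \<sigma> \<delta> \<theta> \<phi> + 1 / real n * (\<Sum>k=1..n. g k)) * (s - r)
    \<le> F_real n x \<tau> \<mu> \<sigma> \<delta> s \<theta> \<phi>"
proof -
  have "max (excess x \<tau> \<theta> \<phi> r k) 0 + g k * (s - r) \<le> max (excess x \<tau> \<theta> \<phi> s k) 0" for k
    using g[of k] excess_subgradient[OF assms(1-3), of x \<tau> k] by (auto simp: max_def)
  then have "(\<Sum>k=1..n. max (excess x \<tau> \<theta> \<phi> r k) 0 + g k * (s - r))
      \<le> (\<Sum>k=1..n. max (excess x \<tau> \<theta> \<phi> s k) 0)"
    by (intro sum_mono)
  then have "1 / real n * ((\<Sum>k=1..n. max (excess x \<tau> \<theta> \<phi> r k) 0) + (\<Sum>k=1..n. g k) * (s - r))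
      \<le> 1 / real n * (\<Sum>k=1..n. max (excess x \<tau> \<theta> \<phi> s k) 0)"
    by (intro mult_left_mono) (auto simp: sum.distrib sum_distrib_right)
  then show ?thesis
    unfolding F_real_def distrib_left distrib_right right_diff_distrib mult.assoc
    by (simp add: mult.commute)
qed

lemma critical_imp_pos:
  assumes "n \<ge> 1" "critical n x \<tau> \<mu> \<sigma> \<delta> r \<theta> \<phi>"
  shows "r > 0"
  using assms F_eq_PInf[OF assms(1), of 0] 
  by (cases "r = 0") (auto simp: critical_def subdiff_on_def)

lemma critical_iff_minimal:
  assumes "n \<ge> 1" "r > 0" "a_tilde \<theta> \<phi> > 0"
  shows "critical n x \<tau> \<mu> \<sigma> \<delta> r \<theta> \<phi> \<longleftrightarrow>
    (\<forall>s>0. F_real n x \<tau> \<mu> \<sigma> \<delta> r \<theta> \<phi> \<le> F_real n x \<tau> \<mu> \<sigma> \<delta> s \<theta> \<phi>)"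
proof -
  have "F n x \<tau> \<mu> \<sigma> \<delta> 0 \<theta> \<phi> = \<infinity>"
    using assms by (intro F_eq_PInf) auto
  then have "(\<forall>s\<in>{0..}. ereal (F_real n x \<tau> \<mu> \<sigma> \<delta> r \<theta> \<phi>) \<le> F n x \<tau> \<mu> \<sigma> \<delta> s \<theta> \<phi>)
      \<longleftrightarrow> (\<forall>s>0. F_real n x \<tau> \<mu> \<sigma> \<delta> r \<theta> \<phi> \<le> F_real n x \<tau> \<mu> \<sigma> \<delta> s \<theta> \<phi>)"
    using F_eq_F_real[OF assms(1) _ assms(3), of _ x \<tau> \<mu> \<sigma> \<delta>]
    by (metis atLeast_iff ereal_less_eq(1,3) less_eq_real_def)
  then show ?thesis
    using assms by (simp add: critical_def subdiff_on_def F_eq_F_real zero_ereal_def[symmetric])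
qed

text \<open>
  A minimum forces the signs through the difference quotients. Conversely, the subgradient inequality
  of the left formula bounds \<open>F_real\<close> from below for \<open>s \<le> r\<close>, that of the right formula for \<open>s > r\<close>.
\<close>

lemma critical_iff_formulas:
  assumes "n \<ge> 1" and r: "r > 0" and a: "a_tilde \<theta> \<phi> > 0"
  shows "critical n x \<tau> \<mu> \<sigma> \<delta> r \<theta> \<phi> \<longleftrightarrow>
    left_formula n x \<tau> \<mu> \<sigma> \<delta> r \<theta> \<phi> \<le> 0 \<and> 0 \<le> right_formula n x \<tau> \<mu> \<sigma> \<delta> r \<theta> \<phi>"
proof -
  let ?f = "\<lambda>s. F_real n x \<tau> \<mu> \<sigma> \<delta> s \<theta> \<phi>"
  let ?l = "left_formula n x \<tau> \<mu> \<sigma> \<delta> r \<theta> \<phi>" and ?u = "right_formula n x \<tau> \<mu> \<sigma> \<delta> r \<theta> \<phi>"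
  have "?l \<le> 0 \<and> 0 \<le> ?u" if min: "\<forall>s>0. ?f r \<le> ?f s"
  proof
    have "\<forall>\<^sub>F s in at_left r. s \<in> {0<..<r}"
      using r by (intro eventually_at_leftI[of 0]) auto
    then have "\<forall>\<^sub>F s in at_left r. (?f s - ?f r) / (s - r) \<le> 0"
      by eventually_elim (use min in \<open>auto intro!: divide_nonneg_nonpos\<close>)
    then show "?l \<le> 0"
      using F_real_left_derivative[OF r a, of n x \<tau> \<mu> \<sigma> \<delta>]
      unfolding has_field_derivative_iff by (intro tendsto_upperbound) auto
    have "\<forall>\<^sub>F s in at_right r. s > r"
      by (simp add: eventually_at_right_less)
    then have "\<forall>\<^sub>F s in at_right r. (?f s - ?f r) / (s - r) \<ge> 0"
      by eventually_elim (use min r in \<open>auto intro!: divide_nonneg_nonneg\<close>)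
    then show "0 \<le> ?u"
      using F_real_right_derivative[OF r a, of n x \<tau> \<mu> \<sigma> \<delta>]
      unfolding has_field_derivative_iff by (intro tendsto_lowerbound) auto
  qed
  moreover have "?f r \<le> ?f s" if lu: "?l \<le> 0" "0 \<le> ?u" and s: "s > 0" for s
  proof (cases "s \<le> r")
    case True
    have "?f r + ?l * (s - r) \<le> ?f s"
      unfolding left_formula_eq by (rule F_real_subgradient[OF r s a]) auto
    moreover have "0 \<le> ?l * (s - r)"
      using True lu by (simp add: mult_nonpos_nonpos)
    ultimately show ?thesis by linarith
  next
    case False
    have "?f r + ?u * (s - r) \<le> ?f s"
      unfolding right_formula_eq by (rule F_real_subgradient[OF r s a]) auto
    moreover have "0 \<le> ?u * (s - r)"
      using False lu by simp
    ultimately show ?thesis by linarith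
  qed
  ultimately show ?thesis
    unfolding critical_iff_minimal[OF assms] by blast
qed

section \<open>The sign of the slope\<close>

lemma F_real_ge_linear: "r * slope n x \<mu> \<sigma> \<delta> \<theta> \<phi> \<le> F_real n x \<tau> \<mu> \<sigma> \<delta> r \<theta> \<phi>"
  unfolding F_real_def by (simp add: sum_nonneg)

text \<open>
  The positive parts dominate the excesses, whose average is explicit and blows up as \<open>r \<rightarrow> 0\<close>.
\<close>

lemma F_real_ge_reciprocal:
  assumes "n \<ge> 1" "slope n x \<mu> \<sigma> \<delta> \<theta> \<phi> \<ge> 0" "r \<ge> 0"
  shows "\<tau> - 1 / real n * (\<Sum>k=1..n. b_tilde x \<theta> \<phi> k / a_tilde \<theta> \<phi>) + 1 / (4 * r * a_tilde \<theta> \<phi>)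
    \<le> F_real n x \<tau> \<mu> \<sigma> \<delta> r \<theta> \<phi>"
proof -
  have "1 / real n * (\<Sum>k=1..n. excess x \<tau> \<theta> \<phi> r k)
      \<le> 1 / real n * (\<Sum>k=1..n. max (excess x \<tau> \<theta> \<phi> r k) 0)"
    by (intro mult_left_mono sum_mono) auto
  moreover have "1 / real n * (\<Sum>k=1..n. excess x \<tau> \<theta> \<phi> r k) = \<tau> - 1 / real n *
      (\<Sum>k=1..n. b_tilde x \<theta> \<phi> k / a_tilde \<theta> \<phi>) + 1 / (4 * r * a_tilde \<theta> \<phi>)"
    using assms(1) by (simp add: excess_def sum_subtractf algebra_simps add_divide_distrib diff_divide_distrib)
  moreover have "0 \<le> r * slope n x \<mu> \<sigma> \<delta> \<theta> \<phi>" using assms by simp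
  ultimately show ?thesis unfolding F_real_def by linarith
qed

lemma F_real_continuous_on:
  assumes "a_tilde \<theta> \<phi> > 0" "S \<subseteq> {0<..}"
  shows "continuous_on S (\<lambda>s. F_real n x \<tau> \<mu> \<sigma> \<delta> s \<theta> \<phi>)"
  unfolding F_real_def excess_def using assms by (intro continuous_intros) auto

text \<open>
  The lower bound \<open>F_real_ge_reciprocal\<close> exceeds \<open>F_real\<close> at \<open>1\<close> near zero and \<open>F_real_ge_linear\<close>
  does so for large \<open>r\<close>, so that a minimum over a compact interval between them is global.
\<close>

lemma critical_exists:
  assumes n: "n \<ge> 1" and a: "a_tilde \<theta> \<phi> > 0" and C: "slope n x \<mu> \<sigma> \<delta> \<theta> \<phi> > 0"
  shows "\<exists>r. critical n x \<tau> \<mu> \<sigma> \<delta> r \<theta> \<phi>"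
proof -
  let ?f = "\<lambda>s. F_real n x \<tau> \<mu> \<sigma> \<delta> s \<theta> \<phi>" and ?C = "slope n x \<mu> \<sigma> \<delta> \<theta> \<phi>"
  define D where "D = \<tau> - 1 / real n * (\<Sum>k=1..n. b_tilde x \<theta> \<phi> k / a_tilde \<theta> \<phi>)"
  define N where "N = \<bar>?f 1 - D\<bar> + 1"
  define lo where "lo = min 1 (1 / (4 * N * a_tilde \<theta> \<phi>))"
  define hi where "hi = max 1 (?f 1 / ?C)"
  have N: "N > 0" "?f 1 \<le> D + N" unfolding N_def by linarith+
  have lo: "lo > 0" unfolding lo_def using N a by simp
  have "\<exists>r\<in>{lo..hi}. \<forall>s\<in>{lo..hi}. ?f r \<le> ?f s"
  proof (intro continuous_attains_inf F_real_continuous_on a)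
    show "{lo..hi} \<subseteq> {0<..}" using lo by auto
    show "{lo..hi} \<noteq> {}" by (auto simp: lo_def hi_def)
  qed simp
  then obtain r where r: "r \<in> {lo..hi}" and min: "\<And>s. s \<in> {lo..hi} \<Longrightarrow> ?f r \<le> ?f s"
    by blast
  \<comment> \<open>The interval contains \<open>1\<close>, so \<open>?f 1\<close> serves as the level that is exceeded outside.\<close>
  have r1: "?f r \<le> ?f 1" by (rule min) (auto simp: lo_def hi_def)
  have "?f r \<le> ?f s" if s: "s > 0" for s
  proof -
    consider "s \<in> {lo..hi}" | "s < lo" | "s > hi" by fastforce
    then show ?thesis
    proof cases
      case 2
      then have "s < 1 / (4 * N * a_tilde \<theta> \<phi>)" by (simp add: lo_def)
      then have "N < 1 / (4 * s * a_tilde \<theta> \<phi>)"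
        using s a N by (simp add: field_simps)
      then show ?thesis
        using F_real_ge_reciprocal[OF n, of x \<mu> \<sigma> \<delta> \<theta> \<phi> s \<tau>] C s N(2) r1 unfolding D_def by linarith
    next
      case 3
      then have "?f 1 / ?C < s" by (simp add: hi_def)
      then have "?f 1 < s * ?C" using C by (simp add: field_simps)
      then show ?thesis using F_real_ge_linear[of s n x \<mu> \<sigma> \<delta> \<theta> \<phi> \<tau>] r1 by linarith
    qed (use min in auto)
  qed
  moreover have "r > 0" using lo r by simp
  ultimately show ?thesis
    using critical_iff_minimal[OF n _ a] by blast
qed

text \<open>
  For \<open>r \<ge> 1\<close> the positive parts are bounded by their values at \<open>r = 1\<close>.
\<close>

lemma INF_eq_MInf:
  assumes n: "n \<ge> 1" and a: "a_tilde \<theta> \<phi> > 0" and C: "slope n x \<mu> \<sigma> \<delta> \<theta> \<phi> < 0"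
  shows "(INF r\<in>{0..}. F n x \<tau> \<mu> \<sigma> \<delta> r \<theta> \<phi>) = -\<infinity>"
proof (rule ereal_bot)
  fix B :: real
  let ?f = "\<lambda>s. F_real n x \<tau> \<mu> \<sigma> \<delta> s \<theta> \<phi>" and ?C = "slope n x \<mu> \<sigma> \<delta> \<theta> \<phi>"
  define E where "E = 1 / real n * (\<Sum>k=1..n. max (excess x \<tau> \<theta> \<phi> 1 k) 0)"
  define r where "r = max 1 ((B - E) / ?C)"
  have r: "r \<ge> 1" "(B - E) / ?C \<le> r" unfolding r_def by auto
  have "r * ?C \<le> B - E" using r C by (simp add: field_simps)
  moreover have "1 / real n * (\<Sum>k=1..n. max (excess x \<tau> \<theta> \<phi> r k) 0) \<le> E"
    unfolding E_def
    by (intro mult_left_mono sum_mono max.mono excess_antimono) (use r a in auto)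
  ultimately have "?f r \<le> B" unfolding F_real_def by linarith
  then show "(INF r\<in>{0..}. F n x \<tau> \<mu> \<sigma> \<delta> r \<theta> \<phi>) \<le> ereal B"
    using r by (intro INF_lower2[of r]) (auto simp: F_eq_F_real[OF n _ a])
qed

section \<open>Moving admissible angles to generic ones\<close>

lemma grid_meets_neighbourhood:
  assumes \<theta>: "\<theta> \<in> {0..pi}" and \<phi>: "\<phi> \<in> {0..<2 * pi}" and P: "\<forall>\<^sub>F p in nhds (\<theta>, \<phi>). P p"
  shows "\<exists>\<eta>>0. \<forall>\<Theta> \<Phi>. angle_grid \<eta> \<Theta> \<Phi> \<longrightarrow> (\<exists>\<theta>'\<in>\<Theta>. \<exists>\<phi>'\<in>\<Phi>. P (\<theta>', \<phi>'))"
proof -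
  obtain e where e: "e > 0" and Pe: "\<And>p. dist p (\<theta>, \<phi>) < e \<Longrightarrow> P p"
    using P unfolding eventually_nhds_metric by blast
  have "\<exists>\<theta>'\<in>\<Theta>. \<exists>\<phi>'\<in>\<Phi>. P (\<theta>', \<phi>')" if "angle_grid (e / 3) \<Theta> \<Phi>" for \<Theta> \<Phi>
  proof -
    have "\<exists>\<theta>'\<in>\<Theta>. \<bar>\<theta> - \<theta>'\<bar> \<le> e / 3" "\<exists>\<phi>'\<in>\<Phi>. \<bar>\<phi> - \<phi>'\<bar> \<le> e / 3"
      using that \<theta> \<phi> by (simp_all only: angle_grid_def)
    then obtain \<theta>' \<phi>' where g: "\<theta>' \<in> \<Theta>" "\<phi>' \<in> \<Phi>" "\<bar>\<theta> - \<theta>'\<bar> \<le> e / 3" "\<bar>\<phi> - \<phi>'\<bar> \<le> e / 3"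
      by blast
    have "dist (\<theta>', \<phi>') (\<theta>, \<phi>) \<le> \<bar>dist \<theta>' \<theta>\<bar> + \<bar>dist \<phi>' \<phi>\<bar>"
      unfolding dist_Pair_Pair by (rule sqrt_sum_squares_le_sum_abs)
    also have "\<dots> < e" using g e by (simp add: dist_real_def abs_minus_commute)
    finally show ?thesis using g Pe by blast
  qed
  then show ?thesis using e by (intro exI[of _ "e / 3"]) auto
qed

text \<open>
  In the dual variables the slope times \<open>a_tilde\<close> is a quadratic form; the term \<open>(cos \<theta>)\<^sup>2 / 4\<close>, which
  comes from the squares of \<open>b_tilde\<close>, has a coefficient independent of all data.
\<close>

lemma a_tilde_times_slope:
  fixes x :: "nat \<Rightarrow> real" and \<theta> \<phi> \<mu> \<sigma> \<delta> :: real
  assumes n: "n \<ge> 1" and a: "a_tilde \<theta> \<phi> \<noteq> 0"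
  defines "m \<equiv> (\<Sum>k=1..n. x k) / real n" and "m2 \<equiv> (\<Sum>k=1..n. (x k)\<^sup>2) / real n"
    and "w \<equiv> cos \<phi> + sin \<phi>"
  shows "a_tilde \<theta> \<phi> * slope n x \<mu> \<sigma> \<delta> \<theta> \<phi> =
      (sin \<theta>)\<^sup>2 * (w * (cos \<phi> * (\<delta> - m2) + sin \<phi> * (\<sigma>\<^sup>2 + \<mu>\<^sup>2)) + (cos \<phi>)\<^sup>2 * m2)
      + sin \<theta> * cos \<theta> * (w * \<mu> - cos \<phi> * m) + (cos \<theta>)\<^sup>2 / 4"
proof -
  have "(b_tilde x \<theta> \<phi> k)\<^sup>2 = (sin \<theta> * cos \<phi>)\<^sup>2 * (x k)\<^sup>2 - (sin \<theta> * cos \<theta> * cos \<phi>) * x k + (cos \<theta>)\<^sup>2 / 4" for k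
    by (simp add: b_tilde_def power2_eq_square algebra_simps)
  then have "(\<Sum>k=1..n. (b_tilde x \<theta> \<phi> k)\<^sup>2) = (sin \<theta> * cos \<phi>)\<^sup>2 * (\<Sum>k=1..n. (x k)\<^sup>2)
      - (sin \<theta> * cos \<theta> * cos \<phi>) * (\<Sum>k=1..n. x k) + real n * ((cos \<theta>)\<^sup>2 / 4)"
    by (simp only: sum.distrib sum_subtractf sum_distrib_left[symmetric] sum_constant) simp
  then have b: "1 / real n * (\<Sum>k=1..n. (b_tilde x \<theta> \<phi> k)\<^sup>2)
      = (sin \<theta> * cos \<phi>)\<^sup>2 * m2 - (sin \<theta> * cos \<theta> * cos \<phi>) * m + (cos \<theta>)\<^sup>2 / 4"
    using n by (simp add: m_def m2_def field_simps)
  have "a_tilde \<theta> \<phi> * (1 / real n * (\<Sum>k=1..n. beta x \<theta> \<phi> k)) = 1 / real n * (\<Sum>k=1..n. (b_tilde x \<theta> \<phi> k)\<^sup>2)"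
    using a by (simp add: beta_def sum_divide_distrib[symmetric])
  then have "a_tilde \<theta> \<phi> * slope n x \<mu> \<sigma> \<delta> \<theta> \<phi> = a_tilde \<theta> \<phi> * (alpha \<mu> \<sigma> \<delta> \<theta> \<phi> - alpha0 \<theta> \<phi> * m2)
      + ((sin \<theta> * cos \<phi>)\<^sup>2 * m2 - (sin \<theta> * cos \<theta> * cos \<phi>) * m + (cos \<theta>)\<^sup>2 / 4)"
    unfolding slope_def b by (simp add: m2_def distrib_left right_diff_distrib)
  moreover have "a_tilde \<theta> \<phi> = sin \<theta> * w" by (simp add: a_tilde_def w_def)
  ultimately show ?thesis
    by (simp add: alpha_def alpha0_def power2_eq_square algebra_simps)
qed

lemma inj_on_cot: "inj_on (cot :: real \<Rightarrow> real) {0<..<pi}"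
proof (rule inj_onI)
  fix s t :: real
  assume s: "s \<in> {0<..<pi}" and t: "t \<in> {0<..<pi}" and "cot s = cot t"
  then have "sin (s - t) = 0"
    using sin_gt_zero[of s] sin_gt_zero[of t] by (simp add: cot_def sin_diff field_simps)
  then show "s = t"
    using s t sin_eq_0_pi[of "s - t"] by simp
qed

text \<open>
  The data may make the slope vanish identically on a curve of angles, for example on \<open>\<theta> = pi / 2\<close>
  if \<open>\<mu>\<close>, \<open>\<sigma>\<close>, \<open>\<delta>\<close> and all \<open>x k\<close> are zero. Lines of constant \<open>\<phi>\<close> are never contained in such
  a curve, since on them the leading coefficient \<open>1 / 4\<close> in \<open>cot \<theta>\<close> leaves at most two zeros.
\<close>

lemma finite_zeros_slope:
  assumes n: "n \<ge> 1" and w: "cos \<phi> + sin \<phi> > 0"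
  shows "finite {\<theta> \<in> {0<..<pi}. slope n x \<mu> \<sigma> \<delta> \<theta> \<phi> = 0}"
proof -
  define A where "A = (cos \<phi> + sin \<phi>) * (cos \<phi> * (\<delta> - (\<Sum>k=1..n. (x k)\<^sup>2) / real n)
     + sin \<phi> * (\<sigma>\<^sup>2 + \<mu>\<^sup>2)) + (cos \<phi>)\<^sup>2 * ((\<Sum>k=1..n. (x k)\<^sup>2) / real n)"
  define B where "B = (cos \<phi> + sin \<phi>) * \<mu> - cos \<phi> * ((\<Sum>k=1..n. x k) / real n)"
  let ?p = "[:A, B, 1 / 4:]"
  have "poly ?p (cot \<theta>) = 0" if \<theta>: "\<theta> \<in> {0<..<pi}" and z: "slope n x \<mu> \<sigma> \<delta> \<theta> \<phi> = 0" for \<theta>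
  proof -
    have s: "sin \<theta> > 0" using \<theta> by (simp add: sin_gt_zero)
    then have "a_tilde \<theta> \<phi> \<noteq> 0" using w by (simp add: a_tilde_def)
    from a_tilde_times_slope[OF n this, of x \<mu> \<sigma> \<delta>] z
    have "(sin \<theta>)\<^sup>2 * A + sin \<theta> * cos \<theta> * B + (cos \<theta>)\<^sup>2 / 4 = 0"
      by (simp add: A_def B_def)
    moreover have "(sin \<theta>)\<^sup>2 * A + sin \<theta> * cos \<theta> * B + (cos \<theta>)\<^sup>2 / 4 = (sin \<theta>)\<^sup>2 * poly ?p (cot \<theta>)"
      using s by (simp add: cot_def field_simps power2_eq_square)
    ultimately show ?thesis using s by simp
  qed
  then have "{\<theta> \<in> {0<..<pi}. slope n x \<mu> \<sigma> \<delta> \<theta> \<phi> = 0} \<subseteq> cot -` {y. poly ?p y = 0} \<inter> {0<..<pi}"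
    by blast
  moreover have "finite (cot -` {y. poly ?p y = 0} \<inter> {0<..<pi})"
    by (intro finite_vimage_IntI inj_on_cot poly_roots_finite) simp
  ultimately show ?thesis by (rule finite_subset)
qed

lemma isCont_alpha0: "isCont (\<lambda>p. alpha0 (fst p) (snd p)) q"
  unfolding alpha0_def by (intro continuous_intros)

lemma isCont_alpha: "isCont (\<lambda>p. alpha \<mu> \<sigma> \<delta> (fst p) (snd p)) q"
  unfolding alpha_def by (intro continuous_intros isCont_alpha0)

lemma isCont_a_tilde: "isCont (\<lambda>p. a_tilde (fst p) (snd p)) q"
  unfolding a_tilde_def by (intro continuous_intros)

lemma isCont_b_tilde: "isCont (\<lambda>p. b_tilde x (fst p) (snd p) k) q"
  unfolding b_tilde_def by (intro continuous_intros)

lemma isCont_beta: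
  assumes "a_tilde (fst q) (snd q) \<noteq> 0"
  shows "isCont (\<lambda>p. beta x (fst p) (snd p) k) q"
  unfolding beta_def
  by (intro isCont_divide isCont_power isCont_a_tilde isCont_b_tilde assms)

lemma isCont_slope:
  assumes "a_tilde (fst q) (snd q) \<noteq> 0"
  shows "isCont (\<lambda>p. slope n x \<mu> \<sigma> \<delta> (fst p) (snd p)) q"
proof -
  have "slope n x \<mu> \<sigma> \<delta> \<theta> \<phi> = alpha \<mu> \<sigma> \<delta> \<theta> \<phi> - alpha0 \<theta> \<phi> * ((\<Sum>k=1..n. (x k)\<^sup>2) / real n)
      + 1 / real n * (\<Sum>k=1..n. beta x \<theta> \<phi> k)" for \<theta> \<phi>
    by (simp add: slope_def)
  then show ?thesis
    by (simp only:) (intro isCont_add isCont_diff isCont_mult isCont_sum continuous_const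
      isCont_alpha isCont_alpha0 isCont_beta assms ballI)
qed

lemma isCont_excess:
  assumes "a_tilde (fst q) (snd q) \<noteq> 0" "r \<noteq> 0"
  shows "isCont (\<lambda>p. excess x \<tau> (fst p) (snd p) r k) q"
  unfolding excess_def using assms
  by (intro isCont_diff isCont_divide isCont_mult isCont_a_tilde isCont_b_tilde continuous_const) auto

lemma isCont_F_real:
  assumes "a_tilde (fst q) (snd q) \<noteq> 0" "r \<noteq> 0"
  shows "isCont (\<lambda>p. F_real n x \<tau> \<mu> \<sigma> \<delta> r (fst p) (snd p)) q"
  unfolding F_real_def
  by (intro isCont_add isCont_mult isCont_sum continuous_max continuous_const isCont_slope isCont_excess
      assms ballI)

lemma tendsto_slope:
  assumes "a_tilde \<theta> \<phi> \<noteq> 0"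
  shows "((\<lambda>p. slope n x \<mu> \<sigma> \<delta> (fst p) (snd p)) \<longlongrightarrow> slope n x \<mu> \<sigma> \<delta> \<theta> \<phi>) (nhds (\<theta>, \<phi>))"
  using isCont_slope[of "(\<theta>, \<phi>)" n x \<mu> \<sigma> \<delta>]
    tendsto_at_iff_tendsto_nhds[of "\<lambda>p. slope n x \<mu> \<sigma> \<delta> (fst p) (snd p)" "(\<theta>, \<phi>)"]
  by (simp add: isCont_def assms)

lemma tendsto_F_real:
  assumes "a_tilde \<theta> \<phi> \<noteq> 0" "r \<noteq> 0"
  shows "((\<lambda>p. F_real n x \<tau> \<mu> \<sigma> \<delta> r (fst p) (snd p)) \<longlongrightarrow> F_real n x \<tau> \<mu> \<sigma> \<delta> r \<theta> \<phi>)
    (nhds (\<theta>, \<phi>))"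
  using isCont_F_real[of "(\<theta>, \<phi>)" r n x \<tau> \<mu> \<sigma> \<delta>]
    tendsto_at_iff_tendsto_nhds[of "\<lambda>p. F_real n x \<tau> \<mu> \<sigma> \<delta> r (fst p) (snd p)" "(\<theta>, \<phi>)"]
  by (simp add: isCont_def assms)

text \<open>
  The constraint \<open>cos \<phi> \<ge> 0\<close> is active only at \<open>\<phi> = pi / 2\<close>, since \<open>cos \<phi> + sin \<phi> > 0\<close> rules out
  \<open>3 * pi / 2\<close>. There \<open>cos\<close> is strictly decreasing, so a small step to the left makes it positive.
\<close>

lemma admissible_move_phi_to_interior:
  assumes adm: "admissible \<theta> \<phi>" and ran: "\<theta> \<in> {0..pi}" "\<phi> \<in> {0..<2 * pi}"
    and U: "open U" "(\<theta>, \<phi>) \<in> U"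
  obtains \<phi>' where "\<phi>' \<in> {0..<2 * pi}" "(\<theta>, \<phi>') \<in> U" "cos \<phi>' > 0" "cos \<phi>' + sin \<phi>' > 0"
proof -
  have "sin \<theta> \<ge> 0" using ran by (simp add: sin_ge_zero)
  with adm have s: "sin \<theta> > 0" and w: "cos \<phi> + sin \<phi> > 0" and c: "cos \<phi> \<ge> 0"
    by (auto simp: admissible_def zero_less_mult_iff zero_le_mult_iff)
  show thesis
  proof (cases "cos \<phi> = 0")
    case False
    with that[of \<phi>] c w U ran show ?thesis by simp
  next
    case True
    with w have sp: "sin \<phi> > 0" by simp
    with ran have p: "\<phi> > 0" by (cases "\<phi> = 0") auto
    have "(cos has_real_derivative - sin \<phi>) (at \<phi>)"
      by (auto intro!: derivative_eq_intros)
    from DERIV_neg_dec_left[OF this] obtain d where d: "d > 0" and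
      cd: "\<And>h. 0 < h \<Longrightarrow> h < d \<Longrightarrow> 0 < cos (\<phi> - h)" using sp True by auto
    have "\<forall>\<^sub>F t in at_left \<phi>. t \<in> {max 0 (\<phi> - d)<..<\<phi>}"
      using d p by (intro eventually_at_leftI[of "max 0 (\<phi> - d)"]) auto
    moreover have "\<forall>\<^sub>F t in at_left \<phi>. cos t + sin t > 0"
      using w by (intro order_tendstoD(1)[where y = "cos \<phi> + sin \<phi>"] tendsto_intros)
    moreover have "\<forall>\<^sub>F t in at_left \<phi>. (\<theta>, t) \<in> U"
      using U by (intro topological_tendstoD[where l = "(\<theta>, \<phi>)"] tendsto_intros)
    ultimately have "\<forall>\<^sub>F t in at_left \<phi>. t \<in> {0..<2 * pi} \<and> (\<theta>, t) \<in> U \<and> cos t > 0 \<and> cos t + sin t > 0"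
    proof eventually_elim
      case (elim t)
      with cd[of "\<phi> - t"] ran show ?case by auto
    qed
    then have "\<exists>t. t \<in> {0..<2 * pi} \<and> (\<theta>, t) \<in> U \<and> cos t > 0 \<and> cos t + sin t > 0"
      by (intro eventually_happens'[OF trivial_limit_at_left_real])
    with that show ?thesis by blast
  qed
qed

text \<open>
  First \<open>\<phi>\<close> is moved to make the constraint strict, then \<open>\<theta>\<close> to avoid the finitely many zeros of the
  slope. The result holds on a neighbourhood, since by then all conditions are open.
\<close>

lemma generic_admissible_angle:
  assumes n: "n \<ge> 1" and adm: "admissible \<theta> \<phi>"
    and ran: "\<theta> \<in> {0..pi}" "\<phi> \<in> {0..<2 * pi}" and P: "\<forall>\<^sub>F p in nhds (\<theta>, \<phi>). P p"
  obtains \<theta>' \<phi>' where "\<theta>' \<in> {0..pi}" "\<phi>' \<in> {0..<2 * pi}"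
    "\<forall>\<^sub>F p in nhds (\<theta>', \<phi>').
       P p \<and> admissible (fst p) (snd p) \<and> slope n x \<mu> \<sigma> \<delta> (fst p) (snd p) \<noteq> 0"
proof -
  obtain U where U: "open U" "(\<theta>, \<phi>) \<in> U" and UP: "\<And>p. p \<in> U \<Longrightarrow> P p"
    using P unfolding eventually_nhds by blast
  obtain \<phi>' where \<phi>': "\<phi>' \<in> {0..<2 * pi}" "(\<theta>, \<phi>') \<in> U" "cos \<phi>' > 0" "cos \<phi>' + sin \<phi>' > 0"
    using admissible_move_phi_to_interior[OF adm ran U] .
  have "\<theta> \<noteq> 0" "\<theta> \<noteq> pi" using adm by (auto simp: admissible_def)
  with ran have \<theta>: "\<theta> \<in> {0<..<pi}" by auto
  define V where "V = (\<lambda>t. (t, \<phi>')) -` U \<inter> {0<..<pi}"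
  have "open V" unfolding V_def
    by (intro open_Int open_vimage U continuous_intros open_greaterThanLessThan)
  moreover have "V \<noteq> {}" using \<phi>' \<theta> by (auto simp: V_def)
  ultimately have "infinite V" using finite_imp_not_open by blast
  then have "\<not> V \<subseteq> {\<theta> \<in> {0<..<pi}. slope n x \<mu> \<sigma> \<delta> \<theta> \<phi>' = 0}"
    using finite_zeros_slope[OF n \<phi>'(4)] finite_subset by blast
  moreover have "V \<subseteq> {0<..<pi}" by (simp add: V_def)
  ultimately obtain \<theta>' where "\<theta>' \<in> V" and nz: "slope n x \<mu> \<sigma> \<delta> \<theta>' \<phi>' \<noteq> 0"
    by blast
  then have \<theta>': "\<theta>' \<in> {0<..<pi}" "(\<theta>', \<phi>') \<in> U" by (auto simp: V_def)
  have s: "sin \<theta>' > 0" using \<theta>' by (simp add: sin_gt_zero)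
  have a: "a_tilde \<theta>' \<phi>' > 0" using s \<phi>' by (simp add: a_tilde_def)
  have "\<forall>\<^sub>F p in nhds (\<theta>', \<phi>'). p \<in> U"
    using U \<theta>' by (simp add: eventually_nhds_in_open)
  moreover have "\<forall>\<^sub>F p in nhds (\<theta>', \<phi>'). slope n x \<mu> \<sigma> \<delta> (fst p) (snd p) \<in> - {0}"
    using a nz by (intro topological_tendstoD[OF tendsto_slope]) auto
  moreover have "\<forall>\<^sub>F p in nhds (\<theta>', \<phi>'). p \<in> {p. 0 < sin (fst p) * (cos (snd p) + sin (snd p))} \<inter>
      {p. 0 < sin (fst p) * cos (snd p)}"
    using s \<phi>' by (intro eventually_nhds_in_open open_Int open_Collect_less continuous_intros) auto
  ultimately have "\<forall>\<^sub>F p in nhds (\<theta>', \<phi>').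
       P p \<and> admissible (fst p) (snd p) \<and> slope n x \<mu> \<sigma> \<delta> (fst p) (snd p) \<noteq> 0"
    by eventually_elim (auto simp: admissible_def UP)
  with that[of \<theta>' \<phi>'] \<theta>' \<phi>' show ?thesis by auto
qed

lemma grid_meets_generic:
  assumes "n \<ge> 1" "admissible \<theta> \<phi>" "\<theta> \<in> {0..pi}" "\<phi> \<in> {0..<2 * pi}" "\<forall>\<^sub>F p in nhds (\<theta>, \<phi>). P p"
  shows "\<exists>\<eta>>0. \<forall>\<Theta> \<Phi>. angle_grid \<eta> \<Theta> \<Phi> \<longrightarrow>
    (\<exists>\<theta>\<in>\<Theta>. \<exists>\<phi>\<in>\<Phi>. P (\<theta>, \<phi>) \<and> admissible \<theta> \<phi> \<and> slope n x \<mu> \<sigma> \<delta> \<theta> \<phi> \<noteq> 0)"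
proof -
  obtain \<theta>' \<phi>' where "\<theta>' \<in> {0..pi}" "\<phi>' \<in> {0..<2 * pi}"
    "\<forall>\<^sub>F p in nhds (\<theta>', \<phi>'). P p \<and> admissible (fst p) (snd p) \<and> slope n x \<mu> \<sigma> \<delta> (fst p) (snd p) \<noteq> 0"
    using generic_admissible_angle[OF assms] .
  from grid_meets_neighbourhood[OF this] show ?thesis by simp
qed

section \<open>The dual value and the grid search\<close>

lemma admissible_iff_a_tilde: "admissible \<theta> \<phi> \<longleftrightarrow> a_tilde \<theta> \<phi> > 0 \<and> 0 \<le> sin \<theta> * cos \<phi>"
  by (simp add: admissible_def a_tilde_def)

lemma dual_value_le:
  assumes "\<theta> \<in> {0..pi}" "\<phi> \<in> {0..<2 * pi}" "admissible \<theta> \<phi>" "r \<ge> 0"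
  shows "dual_value n x \<tau> \<mu> \<sigma> \<delta> \<le> F n x \<tau> \<mu> \<sigma> \<delta> r \<theta> \<phi>"
proof -
  have "0 \<le> r * sin \<theta> * cos \<phi>"
    using assms(3,4) by (simp add: admissible_def mult.assoc)
  then show ?thesis
    unfolding dual_value_def using assms by (intro INF_lower2[of "(r, \<theta>, \<phi>)"]) auto
qed

text \<open>
  The dual problem also ranges over \<open>r = 0\<close> and over angles that are not admissible, but \<open>F\<close> is
  infinite at such feasible points, so they never witness a value below \<open>c\<close>.
\<close>

lemma dual_value_less_witness:
  assumes n: "n \<ge> 1" and lt: "dual_value n x \<tau> \<mu> \<sigma> \<delta> < c"
  obtains r \<theta> \<phi> where "r > 0" "\<theta> \<in> {0..pi}" "\<phi> \<in> {0..<2 * pi}" "admissible \<theta> \<phi>"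
    "ereal (F_real n x \<tau> \<mu> \<sigma> \<delta> r \<theta> \<phi>) < c"
proof -
  from lt obtain r \<theta> \<phi> where h: "0 \<le> r" "\<theta> \<in> {0..pi}" "\<phi> \<in> {0..<2 * pi}" "0 \<le> r * sin \<theta> * cos \<phi>"
    and F: "F n x \<tau> \<mu> \<sigma> \<delta> r \<theta> \<phi> < c"
    unfolding dual_value_def INF_less_iff by auto
  have "0 < r * a_tilde \<theta> \<phi>"
    using F_eq_PInf[OF n, of r \<theta> \<phi> x \<tau> \<mu> \<sigma> \<delta>] F by (cases "0 < r * a_tilde \<theta> \<phi>") auto
  with h have r: "r > 0" and a: "a_tilde \<theta> \<phi> > 0"
    by (auto simp: zero_less_mult_iff)
  have "0 \<le> sin \<theta> * cos \<phi>" using h(4) r by (simp add: mult.assoc zero_le_mult_iff)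
  with a have "admissible \<theta> \<phi>" by (simp add: admissible_iff_a_tilde)
  with that[OF r h(2,3) this] F show thesis
    by (simp add: F_eq_F_real[OF n r a])
qed

lemma slope_nonneg:
  assumes n: "n \<ge> 1" and fin: "dual_value n x \<tau> \<mu> \<sigma> \<delta> \<noteq> - \<infinity>"
    and "\<theta> \<in> {0..pi}" "\<phi> \<in> {0..<2 * pi}" and adm: "admissible \<theta> \<phi>"
  shows "slope n x \<mu> \<sigma> \<delta> \<theta> \<phi> \<ge> 0"
proof (rule ccontr)
  assume "\<not> ?thesis"
  then have "(INF r\<in>{0..}. F n x \<tau> \<mu> \<sigma> \<delta> r \<theta> \<phi>) = -\<infinity>"
    using adm by (intro INF_eq_MInf n) (auto simp: admissible_iff_a_tilde)
  moreover have "dual_value n x \<tau> \<mu> \<sigma> \<delta> \<le> (INF r\<in>{0..}. F n x \<tau> \<mu> \<sigma> \<delta> r \<theta> \<phi>)"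
    using assms by (intro INF_greatest dual_value_le) auto
  ultimately show False using fin by simp
qed

text \<open>
  A negative value of \<open>F_real\<close> is enough to make the slope negative, since the average of positive
  parts is nonnegative.
\<close>

lemma unbounded_dual:
  assumes n: "n \<ge> 1" and inf: "dual_value n x \<tau> \<mu> \<sigma> \<delta> = - \<infinity>"
  shows "\<exists>\<eta>>0. \<forall>\<Theta> \<Phi>. angle_grid \<eta> \<Theta> \<Phi> \<longrightarrow>
    (\<exists>\<theta>\<in>\<Theta>. \<exists>\<phi>\<in>\<Phi>. admissible \<theta> \<phi> \<and> (INF r\<in>{0..}. F n x \<tau> \<mu> \<sigma> \<delta> r \<theta> \<phi>) = -\<infinity>)"
proof -
  obtain r \<theta> \<phi> where h: "r > 0" "\<theta> \<in> {0..pi}" "\<phi> \<in> {0..<2 * pi}" "admissible \<theta> \<phi>"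
    and neg: "ereal (F_real n x \<tau> \<mu> \<sigma> \<delta> r \<theta> \<phi>) < 0"
    using dual_value_less_witness[OF n, of x \<tau> \<mu> \<sigma> \<delta> 0] inf by auto
  from neg have "r * slope n x \<mu> \<sigma> \<delta> \<theta> \<phi> < 0"
    using F_real_ge_linear[of r n x \<mu> \<sigma> \<delta> \<theta> \<phi> \<tau>] by (simp add: zero_ereal_def)
  then have C: "slope n x \<mu> \<sigma> \<delta> \<theta> \<phi> < 0"
    using h(1) by (simp add: mult_less_0_iff)
  have "\<forall>\<^sub>F p in nhds (\<theta>, \<phi>). slope n x \<mu> \<sigma> \<delta> (fst p) (snd p) < 0"
    using h(4) C by (intro order_tendstoD(2)[OF tendsto_slope]) (auto simp: admissible_iff_a_tilde)
  from grid_meets_generic[OF n h(4,2,3) this, of x \<mu> \<sigma> \<delta>] obtain \<eta> where "\<eta> > 0" and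
    \<eta>: "\<And>\<Theta> \<Phi>. angle_grid \<eta> \<Theta> \<Phi> \<Longrightarrow> \<exists>\<theta>\<in>\<Theta>. \<exists>\<phi>\<in>\<Phi>. slope n x \<mu> \<sigma> \<delta> \<theta> \<phi> < 0 \<and> admissible \<theta> \<phi>"
    by fastforce
  have "\<exists>\<theta>\<in>\<Theta>. \<exists>\<phi>\<in>\<Phi>. admissible \<theta> \<phi> \<and> (INF r\<in>{0..}. F n x \<tau> \<mu> \<sigma> \<delta> r \<theta> \<phi>) = -\<infinity>"
    if "angle_grid \<eta> \<Theta> \<Phi>" for \<Theta> \<Phi>
    using \<eta>[OF that] INF_eq_MInf[OF n] by (meson admissible_iff_a_tilde)
  with \<open>\<eta> > 0\<close> show ?thesis by blast
qed

lemma dual_value_neq_PInf: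
  assumes n: "n \<ge> 1"
  shows "dual_value n x \<tau> \<mu> \<sigma> \<delta> \<noteq> \<infinity>"
proof -
  have adm: "admissible (pi / 2) 0" by (simp add: admissible_def)
  have "dual_value n x \<tau> \<mu> \<sigma> \<delta> \<le> F n x \<tau> \<mu> \<sigma> \<delta> 1 (pi / 2) 0"
    by (rule dual_value_le[OF _ _ adm]) auto
  also have "\<dots> = ereal (F_real n x \<tau> \<mu> \<sigma> \<delta> 1 (pi / 2) 0)"
    using adm n by (intro F_eq_F_real) (auto simp: admissible_iff_a_tilde)
  finally show ?thesis by auto
qed

text \<open>
  The radius \<open>r\<close> of a nearly optimal point is kept while its angles are moved to a grid point; the
  critical point listed there can only improve on \<open>r\<close>.
\<close>

lemma finite_dual:
  assumes n: "n \<ge> 1" and fin: "dual_value n x \<tau> \<mu> \<sigma> \<delta> \<noteq> - \<infinity>" and "\<epsilon> > 0"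
  shows "\<exists>\<eta>>0. \<forall>\<Theta> \<Phi> L. angle_grid \<eta> \<Theta> \<Phi> \<and> search_list n x \<tau> \<mu> \<sigma> \<delta> \<Theta> \<Phi> L \<longrightarrow>
    L \<noteq> [] \<and> dual_value n x \<tau> \<mu> \<sigma> \<delta> \<le> list_min n x \<tau> \<mu> \<sigma> \<delta> L \<and>
    list_min n x \<tau> \<mu> \<sigma> \<delta> L \<le> dual_value n x \<tau> \<mu> \<sigma> \<delta> + ereal \<epsilon>"
proof -
  let ?d = "dual_value n x \<tau> \<mu> \<sigma> \<delta>"
  obtain D where D: "?d = ereal D"
    using fin dual_value_neq_PInf[OF n, of x \<tau> \<mu> \<sigma> \<delta>] by (cases ?d) auto
  have "?d < ereal (D + \<epsilon>)" using D \<open>\<epsilon> > 0\<close> by simp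
  from dual_value_less_witness[OF n this] obtain r \<theta> \<phi>
    where r: "r > 0" and h: "\<theta> \<in> {0..pi}" "\<phi> \<in> {0..<2 * pi}" "admissible \<theta> \<phi>"
      and less: "F_real n x \<tau> \<mu> \<sigma> \<delta> r \<theta> \<phi> < D + \<epsilon>" by auto
  have "\<forall>\<^sub>F p in nhds (\<theta>, \<phi>). F_real n x \<tau> \<mu> \<sigma> \<delta> r (fst p) (snd p) < D + \<epsilon>"
    using h(3) less r by (intro order_tendstoD(2)[OF tendsto_F_real]) (auto simp: admissible_iff_a_tilde)
  from grid_meets_generic[OF n h(3,1,2) this, of x \<mu> \<sigma> \<delta>] obtain \<eta> where "\<eta> > 0" and
    \<eta>: "\<And>\<Theta> \<Phi>. angle_grid \<eta> \<Theta> \<Phi> \<Longrightarrow> \<exists>\<theta>\<in>\<Theta>. \<exists>\<phi>\<in>\<Phi>. F_real n x \<tau> \<mu> \<sigma> \<delta> r \<theta> \<phi> < D + \<epsilon>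
       \<and> admissible \<theta> \<phi> \<and> slope n x \<mu> \<sigma> \<delta> \<theta> \<phi> \<noteq> 0"
    unfolding fst_conv snd_conv by blast
  have "L \<noteq> [] \<and> ?d \<le> list_min n x \<tau> \<mu> \<sigma> \<delta> L \<and> list_min n x \<tau> \<mu> \<sigma> \<delta> L \<le> ?d + ereal \<epsilon>"
    if grid: "angle_grid \<eta> \<Theta> \<Phi>" and L: "search_list n x \<tau> \<mu> \<sigma> \<delta> \<Theta> \<Phi> L" for \<Theta> \<Phi> L
  proof -
    have sub: "\<Theta> \<subseteq> {0..pi}" "\<Phi> \<subseteq> {0..<2 * pi}" using grid by (auto simp: angle_grid_def)
    obtain \<theta>' \<phi>' where g: "\<theta>' \<in> \<Theta>" "\<phi>' \<in> \<Phi>" "admissible \<theta>' \<phi>'" "slope n x \<mu> \<sigma> \<delta> \<theta>' \<phi>' \<noteq> 0"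
      and less': "F_real n x \<tau> \<mu> \<sigma> \<delta> r \<theta>' \<phi>' < D + \<epsilon>"
      using \<eta>[OF grid] by blast
    have a: "a_tilde \<theta>' \<phi>' > 0" using g by (simp add: admissible_iff_a_tilde)
    have "slope n x \<mu> \<sigma> \<delta> \<theta>' \<phi>' > 0"
      using slope_nonneg[OF n fin subsetD[OF sub(1) g(1)] subsetD[OF sub(2) g(2)] g(3)] g(4) by simp
    then have "\<exists>r. critical n x \<tau> \<mu> \<sigma> \<delta> r \<theta>' \<phi>'"
      using critical_exists[OF n a] by blast
    then obtain r' where mem: "(\<theta>', \<phi>', r') \<in> set L"
      using L g unfolding search_list_def by blast
    then have crit: "critical n x \<tau> \<mu> \<sigma> \<delta> r' \<theta>' \<phi>'"
      using L unfolding search_list_def by auto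
    have "F n x \<tau> \<mu> \<sigma> \<delta> r' \<theta>' \<phi>' \<le> F n x \<tau> \<mu> \<sigma> \<delta> r \<theta>' \<phi>'"
      using crit r unfolding critical_def subdiff_on_def by (auto simp: zero_ereal_def[symmetric])
    also have "\<dots> \<le> ?d + ereal \<epsilon>"
      using less' D by (simp add: F_eq_F_real[OF n r a])
    finally have "list_min n x \<tau> \<mu> \<sigma> \<delta> L \<le> ?d + ereal \<epsilon>"
      unfolding list_min_def using mem by (intro Min_le_iff[THEN iffD2]) force+
    moreover have "?d \<le> list_min n x \<tau> \<mu> \<sigma> \<delta> L"
      unfolding list_min_def
    proof (rule Min.boundedI)
      show "(\<lambda>(\<theta>, \<phi>, r). F n x \<tau> \<mu> \<sigma> \<delta> r \<theta> \<phi>) ` set L \<noteq> {}" using mem by auto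
      fix v assume "v \<in> (\<lambda>(\<theta>, \<phi>, r). F n x \<tau> \<mu> \<sigma> \<delta> r \<theta> \<phi>) ` set L"
      then obtain s \<theta> \<phi> where v: "v = F n x \<tau> \<mu> \<sigma> \<delta> s \<theta> \<phi>" and "(\<theta>, \<phi>, s) \<in> set L" by auto
      then have "\<theta> \<in> \<Theta>" "\<phi> \<in> \<Phi>" "admissible \<theta> \<phi>" "critical n x \<tau> \<mu> \<sigma> \<delta> s \<theta> \<phi>"
        using L unfolding search_list_def by auto
      then show "?d \<le> v"
        unfolding v using sub critical_imp_pos[OF n] by (intro dual_value_le) (auto intro: less_imp_le)
    qed simp
    ultimately show ?thesis using mem by auto
  qed
  with \<open>\<eta> > 0\<close> show ?thesis by blast
qed

theorem proposition3p3:
  fixes n :: nat and x :: "nat \<Rightarrow> real" and \<tau> \<mu> \<sigma> \<delta> :: real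
  assumes "n \<ge> 1" and "\<sigma> \<ge> 0" and "\<delta> \<ge> 0"
  shows
    "(\<forall>\<theta>\<in>{0..pi}. \<forall>\<phi>\<in>{0..<2 * pi}. sin \<theta> * (cos \<phi> + sin \<phi>) > 0 \<longrightarrow>
        (\<forall>r. critical n x \<tau> \<mu> \<sigma> \<delta> r \<theta> \<phi> \<longrightarrow> r > 0) \<and>
        (\<forall>r>0.
           \<bar>F n x \<tau> \<mu> \<sigma> \<delta> r \<theta> \<phi>\<bar> \<noteq> \<infinity> \<and>
           ((\<lambda>s. real_of_ereal (F n x \<tau> \<mu> \<sigma> \<delta> s \<theta> \<phi>)) has_real_derivative
              left_formula n x \<tau> \<mu> \<sigma> \<delta> r \<theta> \<phi>) (at_left r) \<and>
           ((\<lambda>s. real_of_ereal (F n x \<tau> \<mu> \<sigma> \<delta> s \<theta> \<phi>)) has_real_derivative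
              right_formula n x \<tau> \<mu> \<sigma> \<delta> r \<theta> \<phi>) (at_right r) \<and>
           (critical n x \<tau> \<mu> \<sigma> \<delta> r \<theta> \<phi> \<longleftrightarrow>
              left_formula n x \<tau> \<mu> \<sigma> \<delta> r \<theta> \<phi> \<le> 0 \<and> 0 \<le> right_formula n x \<tau> \<mu> \<sigma> \<delta> r \<theta> \<phi>)))
     \<and>
     (\<forall>\<epsilon>>0. \<exists>\<eta>>0. \<forall>\<Theta> \<Phi> L.
        angle_grid \<eta> \<Theta> \<Phi> \<and> search_list n x \<tau> \<mu> \<sigma> \<delta> \<Theta> \<Phi> L \<longrightarrow>
          (dual_value n x \<tau> \<mu> \<sigma> \<delta> \<noteq> -\<infinity> \<longrightarrow>
             L \<noteq> [] \<and>
             dual_value n x \<tau> \<mu> \<sigma> \<delta> \<le> list_min n x \<tau> \<mu> \<sigma> \<delta> L \<and>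
             list_min n x \<tau> \<mu> \<sigma> \<delta> L \<le> dual_value n x \<tau> \<mu> \<sigma> \<delta> + ereal \<epsilon>) \<and>
          (dual_value n x \<tau> \<mu> \<sigma> \<delta> = -\<infinity> \<longrightarrow>
             (\<exists>\<theta>\<in>\<Theta>. \<exists>\<phi>\<in>\<Phi>. admissible \<theta> \<phi> \<and> (INF r\<in>{0..}. F n x \<tau> \<mu> \<sigma> \<delta> r \<theta> \<phi>) = -\<infinity>)))"
proof (intro conjI ballI impI allI)
  fix \<theta> \<phi> r :: real
  assume pos: "sin \<theta> * (cos \<phi> + sin \<phi>) > 0"
  then have a: "a_tilde \<theta> \<phi> > 0" by (simp add: a_tilde_def)
  show "r > 0" if "critical n x \<tau> \<mu> \<sigma> \<delta> r \<theta> \<phi>"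
    using critical_imp_pos[OF assms(1) that] .
  assume r: "r > 0"
  have eq: "real_of_ereal (F n x \<tau> \<mu> \<sigma> \<delta> s \<theta> \<phi>) = F_real n x \<tau> \<mu> \<sigma> \<delta> s \<theta> \<phi>" if "s > 0" for s
    using F_eq_F_real[OF assms(1) that a] by simp
  have "\<forall>\<^sub>F s in nhds r. s \<in> {0<..}"
    using r by (intro eventually_nhds_in_open) auto
  then have near: "\<forall>\<^sub>F s in at r within S. real_of_ereal (F n x \<tau> \<mu> \<sigma> \<delta> s \<theta> \<phi>)
      = F_real n x \<tau> \<mu> \<sigma> \<delta> s \<theta> \<phi>" for S
    unfolding eventually_at_filter by eventually_elim (use eq in simp)
  show "\<bar>F n x \<tau> \<mu> \<sigma> \<delta> r \<theta> \<phi>\<bar> \<noteq> \<infinity>"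
    using F_eq_F_real[OF assms(1) r a] by simp
  show "((\<lambda>s. real_of_ereal (F n x \<tau> \<mu> \<sigma> \<delta> s \<theta> \<phi>)) has_real_derivative
      left_formula n x \<tau> \<mu> \<sigma> \<delta> r \<theta> \<phi>) (at_left r)"
    using F_real_left_derivative[OF r a] has_field_derivative_cong_eventually[OF near eq[OF r]] by blast
  show "((\<lambda>s. real_of_ereal (F n x \<tau> \<mu> \<sigma> \<delta> s \<theta> \<phi>)) has_real_derivative
      right_formula n x \<tau> \<mu> \<sigma> \<delta> r \<theta> \<phi>) (at_right r)"
    using F_real_right_derivative[OF r a] has_field_derivative_cong_eventually[OF near eq[OF r]] by blast
  show "critical n x \<tau> \<mu> \<sigma> \<delta> r \<theta> \<phi> \<longleftrightarrow>
      left_formula n x \<tau> \<mu> \<sigma> \<delta> r \<theta> \<phi> \<le> 0 \<and> 0 \<le> right_formula n x \<tau> \<mu> \<sigma> \<delta> r \<theta> \<phi>"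
    by (rule critical_iff_formulas[OF assms(1) r a])
next
  fix \<epsilon> :: real
  assume "\<epsilon> > 0"
  show "\<exists>\<eta>>0. \<forall>\<Theta> \<Phi> L.
        angle_grid \<eta> \<Theta> \<Phi> \<and> search_list n x \<tau> \<mu> \<sigma> \<delta> \<Theta> \<Phi> L \<longrightarrow>
          (dual_value n x \<tau> \<mu> \<sigma> \<delta> \<noteq> -\<infinity> \<longrightarrow>
             L \<noteq> [] \<and>
             dual_value n x \<tau> \<mu> \<sigma> \<delta> \<le> list_min n x \<tau> \<mu> \<sigma> \<delta> L \<and>
             list_min n x \<tau> \<mu> \<sigma> \<delta> L \<le> dual_value n x \<tau> \<mu> \<sigma> \<delta> + ereal \<epsilon>) \<and>
          (dual_value n x \<tau> \<mu> \<sigma> \<delta> = -\<infinity> \<longrightarrow>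
             (\<exists>\<theta>\<in>\<Theta>. \<exists>\<phi>\<in>\<Phi>. admissible \<theta> \<phi> \<and> (INF r\<in>{0..}. F n x \<tau> \<mu> \<sigma> \<delta> r \<theta> \<phi>) = -\<infinity>))"
  proof (cases "dual_value n x \<tau> \<mu> \<sigma> \<delta> = -\<infinity>")
    case True
    with unbounded_dual[OF assms(1) True] show ?thesis by (simp only: simp_thms) blast
  next
    case False
    with finite_dual[OF assms(1) False \<open>\<epsilon> > 0\<close>] show ?thesis by (simp only: simp_thms)
  qed
qed

end
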